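(* Let $H$ be a regular graph on $n \geq 3$ vertices which contains a $2$-factor. If $G$ is a $d$-degenerate graph, then (1) $\mathrm{mind}(G\,\Box\,H) \leq nd + \mathrm{mind}(H)$ and (2) $\mathrm{ch}_\Sigma^e(G\,\Box\,H) \leq nd + \mathrm{mind}(H) + 1$.
   Context: All graphs are finite, simple and loopless. A $2$-factor is a spanning $2$-regular subgraph. A graph is $d$-degenerate if every induced subgraph of it has a vertex of degree (in that subgraph) at most $d$. The Cartesian product $G\,\Box\,H$ has vertex set $V(G)\times V(H)$, with $(u,u')$ and $(v,v')$ adjacent if and only if either $u=v$ and $u'v'\in E(H)$, or $u'=v'$ and $uv\in E(G)$. Monomial index. For a polynomial $P \in \mathbb{R}[x_1,\ldots,x_m]$ and a monomial $M$ occurring in $P$ with nonzero coefficient (after full expansion), let $h(M)$ be the largest exponent of any variable in $M$. The monomial index $\mathrm{mind}(P)$ is the minimum of $h(M)$ over all monomials $M$ of $P$ with nonzero coefficient (with $\mathrm{mind}(0)=\infty$). For a graph $G$ with edges $e_1,\ldots,e_m$, associate the variable $x_i$ with $e_i$, and for each vertex $v$ put $X_v = \sum_{e_i \ni v} x_i$. For an orientation $D$ of $G$ let $P_D(x_1,\ldots,x_m) = \prod_{(u,v)\in E(D)} (X_v - X_u)$. Define $\mathrm{mind}(G) = \mathrm{mind}(P_D)$; this does not depend on the orientation $D$, since changing $D$ changes $P_D$ only by a sign. Edge weight choosability number. $\mathrm{ch}_\Sigma^e(G)$ is the smallest positive integer $k$ such that for every assignment of a list $L_e$ of $k$ real numbers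 to each edge $e$ of $G$ there is a choice of weights $w(e)\in L_e$ ($e \in E(G)$) for which $v \mapsto \sum_{e\ni v} w(e)$ is a proper colouring of $V(G)$ (adjacent vertices get different sums). *)

theory Defs
  imports Complex_Main "HOL-Library.Poly_Mapping" "HOL-Library.Extended_Nat"
begin

section \<open>Finite simple graphs\<close>

datatype 'a graph = Graph (verts: "'a set") (edges: "'a set set")

definition simple_graph :: "'a graph \<Rightarrow> bool" where
  "simple_graph G \<longleftrightarrow> finite (verts G) \<and> (\<forall>e\<in>edges G. e \<subseteq> verts G \<and> card e = 2)"

definition incident_edges :: "'a graph \<Rightarrow> 'a \<Rightarrow> 'a set set" where
  "incident_edges G v = {e \<in> edges G. v \<in> e}"

definition vdegree :: "'a graph \<Rightarrow> 'a \<Rightarrow> nat" where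
  "vdegree G v = card (incident_edges G v)"

definition regular_of_degree :: "nat \<Rightarrow> 'a graph \<Rightarrow> bool" where
  "regular_of_degree r G \<longleftrightarrow> (\<forall>v\<in>verts G. vdegree G v = r)"

definition regular :: "'a graph \<Rightarrow> bool" where
  "regular G \<longleftrightarrow> (\<exists>r. regular_of_degree r G)"

definition subgraph :: "'a graph \<Rightarrow> 'a graph \<Rightarrow> bool" where
  "subgraph F G \<longleftrightarrow> simple_graph F \<and> verts F \<subseteq> verts G \<and> edges F \<subseteq> edges G"

definition two_factor :: "'a graph \<Rightarrow> 'a graph \<Rightarrow> bool" where
  "two_factor F G \<longleftrightarrow> subgraph F G \<and> verts F = verts G \<and> regular_of_degree 2 F"

definition induced_subgraph :: "'a graph \<Rightarrow> 'a set \<Rightarrow> 'a graph" where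
  "induced_subgraph G S = Graph S {e \<in> edges G. e \<subseteq> S}"

text \<open>Only nonempty induced subgraphs are required to have a vertex of small degree.\<close>

definition degenerate :: "nat \<Rightarrow> 'a graph \<Rightarrow> bool" where
  "degenerate d G \<longleftrightarrow>
     (\<forall>S. S \<subseteq> verts G \<and> S \<noteq> {} \<longrightarrow> (\<exists>v\<in>S. vdegree (induced_subgraph G S) v \<le> d))"

definition cart_prod :: "'a graph \<Rightarrow> 'b graph \<Rightarrow> ('a \<times> 'b) graph" (infixl \<open>\<box>\<close> 70) where
  "G \<box> H = Graph (verts G \<times> verts H)
     {{(u, u'), (v, v')} | u u' v v'.
        (u, u') \<in> verts G \<times> verts H \<and> (v, v') \<in> verts G \<times> verts H \<and>
        (u = v \<and> {u', v'} \<in> edges H \<or> u' = v' \<and> {u, v} \<in> edges G)}"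


section \<open>Monomial index\<close>

text \<open>
  A polynomial in variables indexed by \<open>'x\<close> maps monomials (exponent vectors
  \<open>'x \<Rightarrow>\<^sub>0 nat\<close>) to real coefficients; \<open>Poly_Mapping.keys P\<close> is the set of monomials
  with nonzero coefficient.
\<close>

type_synonym 'x mpolynomial = "('x \<Rightarrow>\<^sub>0 nat) \<Rightarrow>\<^sub>0 real"

definition pvar :: "'x \<Rightarrow> 'x mpolynomial" where
  "pvar x = Poly_Mapping.single (Poly_Mapping.single x 1) 1"

text \<open>The constant monomial has largest exponent \<open>0\<close>.\<close>

definition max_exponent :: "('x \<Rightarrow>\<^sub>0 nat) \<Rightarrow> nat" where
  "max_exponent M = Max {Poly_Mapping.lookup M x | x. True}"

text \<open>The infimum of the empty set in \<^typ>\<open>enat\<close> is \<open>\<infinity>\<close>, so the zero polynomial gets \<open>\<infinity>\<close>.\<close>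

definition poly_mind :: "'x mpolynomial \<Rightarrow> enat" where
  "poly_mind P = (INF M\<in>Poly_Mapping.keys P. enat (max_exponent M))"

text \<open>\<open>D\<close> contains exactly one of \<open>(u, v)\<close>, \<open>(v, u)\<close> for every edge \<open>{u, v}\<close>, and nothing else.\<close>

definition orientation :: "'a graph \<Rightarrow> ('a \<times> 'a) set \<Rightarrow> bool" where
  "orientation G D \<longleftrightarrow> bij_betw (\<lambda>(u, v). {u, v}) D (edges G)"

definition vertex_poly :: "'a graph \<Rightarrow> 'a \<Rightarrow> 'a set mpolynomial" where
  "vertex_poly G v = (\<Sum>e\<in>incident_edges G v. pvar e)"

definition orientation_poly :: "'a graph \<Rightarrow> ('a \<times> 'a) set \<Rightarrow> 'a set mpolynomial" where
  "orientation_poly G D = (\<Prod>(u, v)\<in>D. vertex_poly G v - vertex_poly G u)"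

text \<open>
  The choice of the orientation is immaterial: see \<open>orientation_exists\<close> and
  \<open>graph_mind_eq\<close> below.
\<close>

definition graph_mind :: "'a graph \<Rightarrow> enat" where
  "graph_mind G = poly_mind (orientation_poly G (SOME D. orientation G D))"

lemma orientation_exists:
  assumes "simple_graph G"
  shows "\<exists>D. orientation G D"
proof -
  have "\<forall>e\<in>edges G. \<exists>p. (\<lambda>(u, v). {u, v}) p = e"
  proof
    fix e assume "e \<in> edges G"
    then obtain u v where "e = {u, v}"
      using assms by (auto simp: simple_graph_def card_2_iff)
    then show "\<exists>p. (\<lambda>(u, v). {u, v}) p = e"
      by (intro exI[of _ "(u, v)"]) simp
  qed
  then obtain f where f: "\<And>e. e \<in> edges G \<Longrightarrow> (\<lambda>(u, v). {u, v}) (f e) = e"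
    by metis
  have "bij_betw f (edges G) (f ` edges G)"
    by (rule inj_on_imp_bij_betw, rule inj_on_inverseI, erule f)
  moreover have "bij_betw ((\<lambda>(u, v). {u, v}) \<circ> f) (edges G) (edges G)"
    by (rule iffD2[OF bij_betw_cong bij_betw_id]) (simp only: o_apply f id_apply)
  ultimately have "orientation G (f ` edges G)"
    unfolding orientation_def by (rule iffD2[OF bij_betw_comp_iff])
  then show ?thesis ..
qed

lemma prod_eq_up_to_sign:
  fixes f g :: "'a \<Rightarrow> 'b :: comm_ring_1"
  assumes "\<And>x. x \<in> A \<Longrightarrow> f x = g x \<or> f x = - g x"
  shows "prod f A = prod g A \<or> prod f A = - prod g A"
  using assms
proof (induction A rule: infinite_finite_induct)
  case (insert x A)
  then have "f x = g x \<or> f x = - g x" "prod f A = prod g A \<or> prod f A = - prod g A"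
    by auto
  then show ?case using insert.hyps by auto
qed auto

lemma orientation_poly_up_to_sign:
  assumes "orientation G D" "orientation G D'"
  shows "orientation_poly G D = orientation_poly G D' \<or>
         orientation_poly G D = - orientation_poly G D'"
proof -
  let ?h = "\<lambda>(u, v). {u, v}"
  let ?t = "\<lambda>(u, v). vertex_poly G v - vertex_poly G u"
  have *: "orientation_poly G E = (\<Prod>e\<in>edges G. ?t (inv_into E ?h e))"
    if "orientation G E" for E
    unfolding orientation_poly_def
    by (rule prod.reindex_bij_betw[symmetric])
       (use that in \<open>auto simp: orientation_def intro: bij_betw_inv_into\<close>)
  have "?t (inv_into D ?h e) = ?t (inv_into D' ?h e) \<or>
        ?t (inv_into D ?h e) = - ?t (inv_into D' ?h e)" if e: "e \<in> edges G" for e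
  proof -
    have 1: "?h (inv_into D ?h e) = e" "?h (inv_into D' ?h e) = e"
      using assms e by (auto simp only: orientation_def bij_betw_inv_into_right)
    obtain a b c d where 2: "inv_into D ?h e = (a, b)" "inv_into D' ?h e = (c, d)"
      by fastforce
    have "{a, b} = {c, d}" using 1 unfolding 2 by simp
    then show ?thesis unfolding 2 by (auto simp: doubleton_eq_iff)
  qed
  from prod_eq_up_to_sign[OF this] show ?thesis
    unfolding *[OF assms(1)] *[OF assms(2)] .
qed

lemma graph_mind_eq:
  assumes "orientation G D"
  shows "graph_mind G = poly_mind (orientation_poly G D)"
proof -
  have "orientation G (SOME D. orientation G D)"
    using assms by (rule someI)
  from orientation_poly_up_to_sign[OF this assms] show ?thesis
    unfolding graph_mind_def poly_mind_def by auto
qed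


section \<open>Edge weight choosability\<close>

definition proper_edge_weighting :: "'a graph \<Rightarrow> ('a set \<Rightarrow> real) \<Rightarrow> bool" where
  "proper_edge_weighting G w \<longleftrightarrow>
     (\<forall>u v. {u, v} \<in> edges G \<longrightarrow>
        (\<Sum>e\<in>incident_edges G u. w e) \<noteq> (\<Sum>e\<in>incident_edges G v. w e))"

definition edge_weight_choosable :: "nat \<Rightarrow> 'a graph \<Rightarrow> bool" where
  "edge_weight_choosable k G \<longleftrightarrow>
     (\<forall>L :: 'a set \<Rightarrow> real set. (\<forall>e\<in>edges G. finite (L e) \<and> card (L e) = k) \<longrightarrow>
        (\<exists>w. (\<forall>e\<in>edges G. w e \<in> L e) \<and> proper_edge_weighting G w))"

text \<open>The value is \<open>\<infinity>\<close> if no list size suffices, as happens for a single edge.\<close>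

definition edge_weight_choosability :: "'a graph \<Rightarrow> enat" where
  "edge_weight_choosability G = (INF k\<in>{k. k > 0 \<and> edge_weight_choosable k G}. enat k)"

end

theory Submission
  imports Defs "HOL-Library.FuncSet" "HOL-Computational_Algebra.Polynomial"
begin

text \<open>
  Order the vertices of \<open>G\<close> so that each has at most \<open>d\<close> earlier neighbours, and let \<open>v\<close> be the
  last one. Translate all variables of the copy \<open>H\<^sub>v\<close> of \<open>H\<close> by one new variable \<open>s\<close>. As \<open>H\<close> is
  \<open>r\<close>-regular, every vertex sum in \<open>H\<^sub>v\<close> grows by \<open>r s\<close> and all others are unchanged, so exactly the
  at most \<open>n d\<close> factors joining \<open>H\<^sub>v\<close> to earlier copies depend on \<open>s\<close>, each with leading coefficient
  \<open>\<plusminus>r \<noteq> 0\<close>. The top coefficient in \<open>s\<close> is therefore a nonzero multiple of the product of the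
  remaining factors, and passing from that coefficient back to the whole polynomial raises only the
  exponents of variables in \<open>H\<^sub>v\<close>, by at most \<open>n d\<close>. The remaining factors split into those
  of \<open>H\<^sub>v\<close>, which contain a copy of the polynomial of \<open>H\<close>, and those of \<open>(G - v) \<box> H\<close>.
  The bound on the choosability number follows by the combinatorial Nullstellensatz, since the
  polynomial of a graph is homogeneous.
\<close>

section \<open>Evaluation of polynomials\<close>

abbreviation const_poly :: "real \<Rightarrow> 'x mpolynomial" where
  "const_poly a \<equiv> Poly_Mapping.single 0 a"

lemma mpoly_induct [case_names monom add]:
  fixes p :: "'x mpolynomial"
  assumes monom: "\<And>M a. Q (Poly_Mapping.single M a)"
    and add: "\<And>p q. Q p \<Longrightarrow> Q q \<Longrightarrow> Q (p + q)"
  shows "Q p"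
proof (induction p rule: Poly_Mapping.update_induct)
  case const
  show ?case using monom[of 0 0] by simp
next
  case (update f a b)
  have "Poly_Mapping.update a b f = f + Poly_Mapping.single a b"
    using update.hyps(1)
    by (intro poly_mapping_eqI)
      (auto simp: lookup_update lookup_add lookup_single in_keys_iff when_def)
  then show ?case using update.IH monom add by simp
qed

definition monom_eval :: "('x \<Rightarrow> 'r::comm_ring_1) \<Rightarrow> ('x \<Rightarrow>\<^sub>0 nat) \<Rightarrow> 'r" where
  "monom_eval w M = (\<Prod>x\<in>Poly_Mapping.keys M. w x ^ Poly_Mapping.lookup M x)"

lemma monom_eval_superset:
  assumes "finite A" "Poly_Mapping.keys M \<subseteq> A"
  shows "monom_eval w M = (\<Prod>x\<in>A. w x ^ Poly_Mapping.lookup M x)"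
  unfolding monom_eval_def
  by (rule prod.mono_neutral_left) (use assms in \<open>auto simp: in_keys_iff\<close>)

lemma monom_eval_0 [simp]: "monom_eval w 0 = 1"
  by (simp add: monom_eval_def)

lemma monom_eval_single: "monom_eval w (Poly_Mapping.single x n) = w x ^ n"
  by (simp add: monom_eval_def)

lemma monom_eval_add: "monom_eval w (M + N) = monom_eval w M * monom_eval w N"
proof -
  let ?A = "Poly_Mapping.keys M \<union> Poly_Mapping.keys N"
  have "monom_eval w K = (\<Prod>x\<in>?A. w x ^ Poly_Mapping.lookup K x)" if "K \<in> {M, N, M + N}" for K
    by (rule monom_eval_superset) (use that keys_add[of M N] in auto)
  then show ?thesis
    by (simp add: lookup_add power_add prod.distrib)
qed

text \<open>The coefficient map \<open>c\<close> is a parameter because one evaluation serves three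
  targets: real numbers for weightings, polynomials in other variables for relabelling, and
  univariate polynomials over polynomials for shifting.\<close>

definition mpoly_eval :: "(real \<Rightarrow> 'r::comm_ring_1) \<Rightarrow> ('x \<Rightarrow> 'r) \<Rightarrow> 'x mpolynomial \<Rightarrow> 'r" where
  "mpoly_eval c w P =
    (\<Sum>M\<in>Poly_Mapping.keys P. c (Poly_Mapping.lookup P M) * monom_eval w M)"

locale real_ring_hom =
  fixes c :: "real \<Rightarrow> 'r::comm_ring_1"
  assumes hom_0: "c 0 = 0" and hom_1: "c 1 = 1"
    and hom_add: "c (a + b) = c a + c b" and hom_mult: "c (a * b) = c a * c b"
begin

lemma eval_single: "mpoly_eval c w (Poly_Mapping.single M a) = c a * monom_eval w M"
  by (simp add: mpoly_eval_def hom_0)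

lemma eval_0 [simp]: "mpoly_eval c w 0 = 0"
  by (simp add: mpoly_eval_def)

lemma eval_1 [simp]: "mpoly_eval c w 1 = 1"
  by (simp add: mpoly_eval_def hom_1)

lemma eval_pvar [simp]: "mpoly_eval c w (pvar x) = w x"
  by (simp add: pvar_def eval_single monom_eval_single hom_1)

lemma eval_add: "mpoly_eval c w (P + Q) = mpoly_eval c w P + mpoly_eval c w Q"
  unfolding mpoly_eval_def
  by (rule setsum_keys_plus_distrib) (auto simp: hom_0 hom_add algebra_simps)

lemma eval_diff: "mpoly_eval c w (P - Q) = mpoly_eval c w P - mpoly_eval c w Q"
  using eval_add[of w "P - Q" Q] by simp

lemma eval_mult: "mpoly_eval c w (P * Q) = mpoly_eval c w P * mpoly_eval c w Q"
proof (induction P rule: mpoly_induct)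
  case (monom M a)
  show ?case
    by (induction Q rule: mpoly_induct)
      (auto simp: mult_single eval_single hom_mult monom_eval_add eval_add algebra_simps)
next
  case (add p q)
  then show ?case by (simp add: eval_add algebra_simps)
qed

lemma eval_sum: "mpoly_eval c w (sum f A) = (\<Sum>i\<in>A. mpoly_eval c w (f i))"
  by (induction A rule: infinite_finite_induct) (auto simp: eval_add)

lemma eval_prod: "mpoly_eval c w (prod f A) = (\<Prod>i\<in>A. mpoly_eval c w (f i))"
  by (induction A rule: infinite_finite_induct) (auto simp: eval_mult)

lemma eval_vertex_poly: "mpoly_eval c w (vertex_poly G v) = (\<Sum>e\<in>incident_edges G v. w e)"
  by (simp add: vertex_poly_def eval_sum)

lemma eval_orientation_poly:
  "mpoly_eval c w (orientation_poly G D) =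
    (\<Prod>(u, v)\<in>D. (\<Sum>e\<in>incident_edges G v. w e) - (\<Sum>e\<in>incident_edges G u. w e))"
  by (simp add: orientation_poly_def eval_prod eval_diff eval_vertex_poly case_prod_unfold)

end

interpretation real_id: real_ring_hom "\<lambda>a. a :: real"
  by (rule real_ring_hom.intro) simp_all

interpretation real_const: real_ring_hom const_poly
  by (rule real_ring_hom.intro) (simp_all add: single_add mult_single)

interpretation real_const_poly: real_ring_hom "\<lambda>a. [:const_poly a:]"
  by (rule real_ring_hom.intro)
    (simp_all add: single_add mult_single pCons_one mult.commute)


section \<open>Monomials with bounded exponents\<close>

text \<open>The bound may differ from variable to variable, since the induction over layers has to
  keep apart the variables of different copies of \<open>H\<close>.\<close>

definition has_monom_le :: "('x \<Rightarrow> nat) \<Rightarrow> 'x mpolynomial \<Rightarrow> bool" where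
  "has_monom_le b P \<longleftrightarrow> (\<exists>M\<in>Poly_Mapping.keys P. \<forall>x. Poly_Mapping.lookup M x \<le> b x)"

lemma has_monom_le_mono:
  "has_monom_le b P \<Longrightarrow> (\<And>x. b x \<le> b' x) \<Longrightarrow> has_monom_le b' P"
  unfolding has_monom_le_def by (meson order_trans)

lemma max_exponent_le_iff: "max_exponent M \<le> k \<longleftrightarrow> (\<forall>x. Poly_Mapping.lookup M x \<le> k)"
proof -
  have "{Poly_Mapping.lookup M x | x. True} \<subseteq>
      insert 0 (Poly_Mapping.lookup M ` Poly_Mapping.keys M)"
    by (auto simp: in_keys_iff)
  then have "finite {Poly_Mapping.lookup M x | x. True}"
    by (rule finite_subset) simp
  then show ?thesis
    unfolding max_exponent_def by (subst Max_le_iff) auto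
qed

lemma poly_mind_le_iff: "poly_mind P \<le> enat k \<longleftrightarrow> has_monom_le (\<lambda>_. k) P"
proof
  assume "poly_mind P \<le> enat k"
  \<comment> \<open>The strict bound by \<open>Suc k\<close> yields a monomial that witnesses the
    infimum.\<close>
  then have "poly_mind P < enat (Suc k)"
    by (rule le_less_trans) simp
  then obtain M where "M \<in> Poly_Mapping.keys P" "max_exponent M < Suc k"
    unfolding poly_mind_def INF_less_iff by auto
  then show "has_monom_le (\<lambda>_. k) P"
    by (auto simp: has_monom_le_def max_exponent_le_iff[symmetric] less_Suc_eq_le)
next
  assume "has_monom_le (\<lambda>_. k) P"
  then obtain M where "M \<in> Poly_Mapping.keys P" "max_exponent M \<le> k"
    by (auto simp: has_monom_le_def max_exponent_le_iff)
  then show "poly_mind P \<le> enat k"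
    unfolding poly_mind_def by (meson INF_lower2 enat_ord_simps(1))
qed

section \<open>Coefficients of products that cannot cancel\<close>

lemma lookup_mult_keys:
  fixes P Q :: "'x mpolynomial"
  shows "Poly_Mapping.lookup (P * Q) K =
    (\<Sum>(M, N)\<in>Poly_Mapping.keys P \<times> Poly_Mapping.keys Q.
      Poly_Mapping.lookup P M * Poly_Mapping.lookup Q N when K = M + N)"
proof -
  have sum_monoms: "(\<Sum>M\<in>Poly_Mapping.keys R. Poly_Mapping.single M (Poly_Mapping.lookup R M)) = R"
    for R :: "'x mpolynomial"
    by (rule poly_mapping_eqI) (simp add: lookup_sum lookup_single when_def not_in_keys_iff_lookup_eq_zero)
  have "P * Q = (\<Sum>M\<in>Poly_Mapping.keys P. \<Sum>N\<in>Poly_Mapping.keys Q.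
      Poly_Mapping.single (M + N) (Poly_Mapping.lookup P M * Poly_Mapping.lookup Q N))"
    by (subst (1 2) sum_monoms[symmetric]) (simp only: sum_product mult_single)
  then show ?thesis
    by (simp add: sum.cartesian_product lookup_sum lookup_single case_prod_unfold eq_commute[of K])
qed

text \<open>The monomial \<open>M + N\<close> arises in only one way, so it does not cancel. If
  \<open>M' + N' = M + N\<close>, then on \<open>A\<close> both \<open>N\<close> and
  \<open>N'\<close> vanish, which gives \<open>M' = M\<close> there; on \<open>B\<close> the roles
  are exchanged; elsewhere \<open>M\<close> and \<open>N\<close> vanish, hence so do
  \<open>M'\<close> and \<open>N'\<close>. Variables outside \<open>A\<close> and \<open>B\<close>
  may occur in both polynomials.\<close>

lemma has_monom_le_mult:
  assumes P: "has_monom_le b P" and Q: "has_monom_le b' Q"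
    and b: "\<And>x. x \<notin> A \<Longrightarrow> b x = 0" and b': "\<And>x. x \<notin> B \<Longrightarrow> b' x = 0"
    and disj: "A \<inter> B = {}"
    and PB: "\<And>M x. M \<in> Poly_Mapping.keys P \<Longrightarrow> x \<in> B \<Longrightarrow> Poly_Mapping.lookup M x = 0"
    and QA: "\<And>M x. M \<in> Poly_Mapping.keys Q \<Longrightarrow> x \<in> A \<Longrightarrow> Poly_Mapping.lookup M x = 0"
  shows "has_monom_le (\<lambda>x. b x + b' x) (P * Q)"
proof -
  obtain M where M: "M \<in> Poly_Mapping.keys P" "\<And>x. Poly_Mapping.lookup M x \<le> b x"
    using P by (auto simp: has_monom_le_def)
  obtain N where N: "N \<in> Poly_Mapping.keys Q" "\<And>x. Poly_Mapping.lookup N x \<le> b' x"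
    using Q by (auto simp: has_monom_le_def)
  have uniq: "M' = M \<and> N' = N"
    if "M' \<in> Poly_Mapping.keys P" "N' \<in> Poly_Mapping.keys Q" "M + N = M' + N'" for M' N'
  proof -
    have "Poly_Mapping.lookup M' x = Poly_Mapping.lookup M x \<and>
        Poly_Mapping.lookup N' x = Poly_Mapping.lookup N x" for x
    proof -
      have "Poly_Mapping.lookup M x + Poly_Mapping.lookup N x =
          Poly_Mapping.lookup M' x + Poly_Mapping.lookup N' x"
        using that(3) by (metis lookup_add)
      moreover have "x \<in> B \<Longrightarrow> Poly_Mapping.lookup M' x = 0 \<and> Poly_Mapping.lookup M x = 0"
        using PB that M by blast
      moreover have "x \<in> A \<Longrightarrow> Poly_Mapping.lookup N' x = 0 \<and> Poly_Mapping.lookup N x = 0"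
        using QA that N by blast
      moreover have "x \<notin> A \<Longrightarrow> Poly_Mapping.lookup M x = 0"
        using b M(2)[of x] by simp
      moreover have "x \<notin> B \<Longrightarrow> Poly_Mapping.lookup N x = 0"
        using b' N(2)[of x] by simp
      ultimately show ?thesis using disj by (cases "x \<in> A"; cases "x \<in> B") auto
    qed
    then show ?thesis by (intro conjI poly_mapping_eqI) simp_all
  qed
  have "Poly_Mapping.lookup (P * Q) (M + N) =
      (\<Sum>p\<in>Poly_Mapping.keys P \<times> Poly_Mapping.keys Q.
        if p = (M, N) then Poly_Mapping.lookup P M * Poly_Mapping.lookup Q N else 0)"
    unfolding lookup_mult_keys
  proof (rule sum.cong[OF refl])
    fix p assume "p \<in> Poly_Mapping.keys P \<times> Poly_Mapping.keys Q"
    then obtain M' N' where p: "p = (M', N')" "M' \<in> Poly_Mapping.keys P" "N' \<in> Poly_Mapping.keys Q"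
      by blast
    show "(case p of (M', N') \<Rightarrow>
        Poly_Mapping.lookup P M' * Poly_Mapping.lookup Q N' when M + N = M' + N') =
      (if p = (M, N) then Poly_Mapping.lookup P M * Poly_Mapping.lookup Q N else 0)"
    proof (cases "p = (M, N)")
      case False
      then have "\<not> (M' = M \<and> N' = N)" using p(1) by auto
      then have "M + N \<noteq> M' + N'" using uniq[OF p(2,3)] by blast
      then have "(Poly_Mapping.lookup P M' * Poly_Mapping.lookup Q N' when M + N = M' + N') = 0"
        by (simp only: when_def if_False)
      then show ?thesis using False by (simp only: p(1) case_prod_conv if_False)
    qed simp
  qed
  also have "\<dots> = Poly_Mapping.lookup P M * Poly_Mapping.lookup Q N"
    using M(1) N(1) by simp
  finally have "M + N \<in> Poly_Mapping.keys (P * Q)"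
    using M(1) N(1) by (simp only: in_keys_iff mult_eq_0_iff de_Morgan_disj simp_thms)
  moreover have "\<forall>x. Poly_Mapping.lookup (M + N) x \<le> b x + b' x"
    using M(2) N(2) by (simp add: lookup_add add_mono)
  ultimately show ?thesis
    unfolding has_monom_le_def by blast
qed

lemma has_monom_le_mult_const:
  assumes "has_monom_le b P" "a \<noteq> 0"
  shows "has_monom_le b (P * const_poly a)"
proof -
  have "has_monom_le (\<lambda>_. 0) (const_poly a)"
    using assms(2) by (simp add: has_monom_le_def)
  then have "has_monom_le (\<lambda>x. b x + 0) (P * const_poly a)"
    by (rule has_monom_le_mult[OF assms(1), where A = UNIV and B = "{}"]) (use assms(2) in auto)
  then show ?thesis by simp
qed

section \<open>Missing variables and relabelling\<close>

definition avoids :: "'x set \<Rightarrow> 'x mpolynomial \<Rightarrow> bool" where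
  "avoids A P \<longleftrightarrow> (\<forall>M\<in>Poly_Mapping.keys P. \<forall>x\<in>A. Poly_Mapping.lookup M x = 0)"

lemma avoids_pvar: "x \<notin> A \<Longrightarrow> avoids A (pvar x)"
  by (auto simp: avoids_def pvar_def lookup_single when_def)

lemma avoids_sum: "(\<And>i. i \<in> I \<Longrightarrow> avoids A (f i)) \<Longrightarrow> avoids A (sum f I)"
  unfolding avoids_def using keys_sum by fastforce

lemma avoids_diff: "avoids A P \<Longrightarrow> avoids A Q \<Longrightarrow> avoids A (P - Q)"
  unfolding avoids_def by (auto simp: in_keys_iff lookup_minus)

lemma avoids_mult: "avoids A P \<Longrightarrow> avoids A Q \<Longrightarrow> avoids A (P * Q)"
  unfolding avoids_def using keys_mult by (fastforce simp: lookup_add)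

lemma avoids_prod: "(\<And>i. i \<in> I \<Longrightarrow> avoids A (f i)) \<Longrightarrow> avoids A (prod f I)"
  by (induction I rule: infinite_finite_induct) (auto simp: avoids_mult, auto simp: avoids_def)

text \<open>A monomial of \<open>P\<close> with a variable outside \<open>A\<close> is mapped to
  zero. Any other becomes a single monomial in which the exponent of \<open>f x\<close> is a sum
  over a fibre of \<open>f\<close>, hence at least the exponent of \<open>x\<close>. Exponent bounds
  can therefore be pulled back along the substitution.\<close>

lemma keys_relabel:
  fixes f :: "'x \<Rightarrow> 'y"
  assumes "M \<in> Poly_Mapping.keys
      (mpoly_eval const_poly (\<lambda>x. if x \<in> A then pvar (f x) else 0) P)"
  shows "\<exists>M'\<in>Poly_Mapping.keys P. \<forall>x. Poly_Mapping.lookup M' x \<le>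
      (if x \<in> A then Poly_Mapping.lookup M (f x) else 0)"
proof -
  let ?w = "\<lambda>x. if x \<in> A then pvar (f x) else 0 :: 'y mpolynomial"
  from subsetD[OF keys_sum assms[unfolded mpoly_eval_def]]
  obtain M' where M': "M' \<in> Poly_Mapping.keys P"
    and "M \<in> Poly_Mapping.keys (const_poly (Poly_Mapping.lookup P M') * monom_eval ?w M')"
    by blast
  then have M: "M \<in> Poly_Mapping.keys (monom_eval ?w M')"
    using keys_mult[of "const_poly (Poly_Mapping.lookup P M')" "monom_eval ?w M'"]
    by (auto split: if_splits)
  have in_A: "x \<in> A" if "x \<in> Poly_Mapping.keys M'" for x
  proof (rule ccontr)
    assume "x \<notin> A"
    then have "monom_eval ?w M' = 0"
      unfolding monom_eval_def using that by (intro prod_zero) (auto simp: in_keys_iff power_0_left)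
    with M show False by simp
  qed
  have power: "pvar y ^ k = Poly_Mapping.single (Poly_Mapping.single y k) 1" for y :: 'y and k
    by (induction k) (auto simp: pvar_def mult_single single_add[symmetric])
  have prod: "(\<Prod>x\<in>B. pvar (f x) ^ m x) =
      (Poly_Mapping.single (\<Sum>x\<in>B. Poly_Mapping.single (f x) (m x)) 1 :: 'y mpolynomial)"
    if "finite B" for B and m :: "'x \<Rightarrow> nat"
    using that by (induction B rule: finite_induct) (auto simp: power mult_single)
  have "monom_eval ?w M' = (\<Prod>x\<in>Poly_Mapping.keys M'. pvar (f x) ^ Poly_Mapping.lookup M' x)"
    unfolding monom_eval_def by (intro prod.cong refl) (use in_A in auto)
  with M have M_eq: "M = (\<Sum>x\<in>Poly_Mapping.keys M'. Poly_Mapping.single (f x) (Poly_Mapping.lookup M' x))"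
    by (simp add: prod)
  have "Poly_Mapping.lookup M' x \<le> Poly_Mapping.lookup M (f x)" for x
  proof (cases "x \<in> Poly_Mapping.keys M'")
    case True
    then have "Poly_Mapping.lookup (Poly_Mapping.single (f x) (Poly_Mapping.lookup M' x)) (f x) \<le>
        Poly_Mapping.lookup M (f x)"
      unfolding M_eq lookup_sum by (intro member_le_sum) auto
    then show ?thesis by simp
  qed (simp add: in_keys_iff)
  then show ?thesis
    using M' in_A by (intro bexI[of _ M']) (auto simp: in_keys_iff)
qed


section \<open>Shifting a set of variables\<close>

lemma coeff_prod_linear:
  assumes "finite I"
  shows "coeff (\<Prod>i\<in>I. [:f i, g i:]) (card I) = (\<Prod>i\<in>I. g i :: 'r::comm_ring_1)"
proof -
  \<comment> \<open>The vanishing of all coefficients above \<open>card I\<close> is carried along: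
    it removes the contribution of the constant term \<open>f x\<close> in the induction
    step.\<close>
  have "coeff (\<Prod>i\<in>I. [:f i, g i:]) (card I) = (\<Prod>i\<in>I. g i) \<and>
      (\<forall>k>card I. coeff (\<Prod>i\<in>I. [:f i, g i:]) k = 0)"
    using assms
  proof (induction I rule: finite_induct)
    case (insert x F)
    then show ?case by (auto simp: coeff_pCons split: nat.split)
  qed simp
  then show ?thesis ..
qed

text \<open>Substitutes \<open>x + s\<close> for each variable \<open>x \<in> W\<close>; the new variable \<open>s\<close> is that of the outer
  univariate polynomial.\<close>

definition shift :: "'x set \<Rightarrow> 'x mpolynomial \<Rightarrow> 'x mpolynomial poly" where
  "shift W = mpoly_eval (\<lambda>a. [:const_poly a:]) (\<lambda>x. [:pvar x, if x \<in> W then 1 else 0:])"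

text \<open>When a product of factors \<open>x + s\<close> and unshifted variables is expanded, each
  \<open>s\<close> taken replaces one variable of \<open>W\<close>. A term in \<open>s^k\<close> has
  lost exactly \<open>k\<close> variables, all of them in \<open>W\<close>.\<close>

lemma keys_coeff_shift_monom:
  assumes "M \<in> Poly_Mapping.keys (coeff (monom_eval (\<lambda>x. [:pvar x, if x \<in> W then 1 else 0:]) M') k)"
  shows "Poly_Mapping.lookup M' x \<le> Poly_Mapping.lookup M x + (if x \<in> W then k else 0)"
proof -
  let ?w = "\<lambda>x. [:pvar x, if x \<in> W then 1 else 0 :: 'a mpolynomial:]"
  \<comment> \<open>\<open>T m p\<close> states the bound for all coefficients of \<open>p\<close>
    at once. Under multiplication the exponent vectors \<open>m\<close> add up, which reduces the
    claim to single variables.\<close>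
  define T where "T m p \<longleftrightarrow> (\<forall>k. \<forall>M\<in>Poly_Mapping.keys (coeff p k). \<forall>x.
      m x \<le> Poly_Mapping.lookup M x + (if x \<in> W then k else 0))"
    for m and p :: "'a mpolynomial poly"
  have T_mult: "T (\<lambda>x. m x + m' x) (p * q)" if "T m p" "T m' q" for m m' p q
    unfolding T_def
  proof (intro allI ballI)
    fix k M x assume "M \<in> Poly_Mapping.keys (coeff (p * q) k)"
    then obtain i where i: "i \<le> k" "M \<in> Poly_Mapping.keys (coeff p i * coeff q (k - i))"
      unfolding coeff_mult using keys_sum by (metis (no_types, lifting) UN_E atMost_iff subsetD)
    then obtain M1 M2 where M: "M = M1 + M2" "M1 \<in> Poly_Mapping.keys (coeff p i)"
      "M2 \<in> Poly_Mapping.keys (coeff q (k - i))"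
      using keys_mult by blast
    have "m x \<le> Poly_Mapping.lookup M1 x + (if x \<in> W then i else 0)"
      "m' x \<le> Poly_Mapping.lookup M2 x + (if x \<in> W then k - i else 0)"
      using that M unfolding T_def by blast+
    then show "m x + m' x \<le> Poly_Mapping.lookup M x + (if x \<in> W then k else 0)"
      using i(1) by (auto simp: M(1) lookup_add split: if_splits)
  qed
  have T_var: "T (\<lambda>x. if x = y then 1 else 0) (?w y)" for y
    unfolding T_def
    by (auto simp: coeff_pCons pvar_def lookup_single when_def split: nat.splits if_splits)
  have T_power: "T (\<lambda>x. if x = y then j else 0) (?w y ^ j)" for y j
  proof (induction j)
    case (Suc j)
    have "(\<lambda>x. (if x = y then 1 else 0) + (if x = y then j else 0)) =
        (\<lambda>x. if x = y then Suc j else 0)"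
      by auto
    with T_mult[OF T_var Suc, of y] show ?case
      by simp
  qed (simp add: T_def)
  have "T (\<lambda>x. if x \<in> A then m x else 0) (\<Prod>x\<in>A. ?w x ^ m x)" if "finite A" for A m
    using that
  proof (induction A rule: finite_induct)
    case (insert y A)
    have "(\<lambda>x. (if x = y then m y else 0) + (if x \<in> A then m x else 0)) =
        (\<lambda>x. if x \<in> insert y A then m x else 0)"
      using insert.hyps by auto
    with T_mult[OF T_power insert.IH, of y "m y"] show ?case
      using insert.hyps by simp
  qed (simp add: T_def)
  from this[of "Poly_Mapping.keys M'" "Poly_Mapping.lookup M'"]
  have "(if x \<in> Poly_Mapping.keys M' then Poly_Mapping.lookup M' x else 0) \<le>
      Poly_Mapping.lookup M x + (if x \<in> W then k else 0)"
    using assms unfolding T_def monom_eval_def by simp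
  then show ?thesis by (auto simp: in_keys_iff split: if_splits)
qed

text \<open>Cancellation may remove monomials from the coefficient of \<open>s^k\<close> but creates
  none: each one that is left descends from a monomial of \<open>P\<close>, which is the
  witness.\<close>

lemma has_monom_le_shift:
  assumes "has_monom_le b (coeff (shift W P) k)"
  shows "has_monom_le (\<lambda>x. b x + (if x \<in> W then k else 0)) P"
proof -
  let ?w = "\<lambda>x. [:pvar x, if x \<in> W then 1 else 0 :: 'a mpolynomial:]"
  obtain M where M: "M \<in> Poly_Mapping.keys (coeff (shift W P) k)"
    and b: "\<And>x. Poly_Mapping.lookup M x \<le> b x"
    using assms by (auto simp: has_monom_le_def)
  obtain M' where M': "M' \<in> Poly_Mapping.keys P"
    and "M \<in> Poly_Mapping.keys (const_poly (Poly_Mapping.lookup P M') * coeff (monom_eval ?w M') k)"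
    using M keys_sum unfolding shift_def mpoly_eval_def coeff_sum by fastforce
  then have "M \<in> Poly_Mapping.keys (coeff (monom_eval ?w M') k)"
    using keys_mult[of "const_poly (Poly_Mapping.lookup P M')" "coeff (monom_eval ?w M') k"]
    by (auto split: if_splits)
  from keys_coeff_shift_monom[OF this] show ?thesis
    unfolding has_monom_le_def using M' b by (meson add_right_mono order_trans)
qed

lemma shift_vertex_poly:
  assumes "finite (edges G)"
  shows "shift W (vertex_poly G v) =
    [:vertex_poly G v, const_poly (real (card (incident_edges G v \<inter> W))):]"
proof -
  have fin: "finite (incident_edges G v)"
    using assms by (simp add: incident_edges_def)
  have "(\<Sum>e\<in>A. [:pvar e, if e \<in> W then 1 else 0 :: 'a set mpolynomial:]) =
      [:\<Sum>e\<in>A. pvar e, \<Sum>e\<in>A. if e \<in> W then 1 else 0:]" if "finite A" for A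
    using that by (induction A rule: finite_induct) auto
  moreover have "(\<Sum>e\<in>incident_edges G v. if e \<in> W then 1 else 0 :: 'a set mpolynomial) =
      const_poly (real (card (incident_edges G v \<inter> W)))"
    using fin by (subst sum.inter_restrict[symmetric]) auto
  ultimately show ?thesis
    using fin unfolding shift_def real_const_poly.eval_vertex_poly by (simp add: vertex_poly_def)
qed


section \<open>The combinatorial Nullstellensatz\<close>

text \<open>The weights are those of the divided difference with nodes \<open>S\<close>, that is,
  \<open>\<phi> s = 1 / (\<Prod>t\<in>S - {s}. s - t)\<close>. They are built here by recursion on
  the nodes.\<close>

lemma divided_difference_exists:
  fixes S :: "real set"
  assumes "finite S" "card S = Suc k"
  shows "\<exists>\<phi>. \<forall>j\<le>k. (\<Sum>s\<in>S. \<phi> s * s ^ j) = (if j = k then 1 else 0)"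
  using assms
proof (induction k arbitrary: S)
  case 0
  then obtain s where "S = {s}" by (auto simp: card_Suc_eq)
  then show ?case by (intro exI[of _ "\<lambda>_. 1"]) simp
next
  case (Suc k)
  then obtain a T where S: "S = insert a T" "a \<notin> T" "card T = Suc k" "finite T"
    by (metis card_Suc_eq finite_insert)
  then obtain \<phi> where \<phi>: "\<And>j. j \<le> k \<Longrightarrow> (\<Sum>s\<in>T. \<phi> s * s ^ j) = (if j = k then 1 else 0)"
    using Suc.IH by blast
  \<comment> \<open>With this value at \<open>a\<close>, applying \<open>\<psi>\<close> to
    \<open>f\<close> amounts to applying \<open>\<phi>\<close> to the difference quotient
    \<open>(f t - f a) / (t - a)\<close>, which lowers degrees by one.\<close>
  define \<psi> where "\<psi> s = (if s = a then - (\<Sum>t\<in>T. \<phi> t / (t - a)) else \<phi> s / (s - a))" for s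
  have \<psi>_sum: "(\<Sum>s\<in>S. \<psi> s * f s) = (\<Sum>t\<in>T. \<phi> t / (t - a) * (f t - f a))" for f
  proof -
    have "(\<Sum>s\<in>T. \<psi> s * f s) = (\<Sum>t\<in>T. \<phi> t / (t - a) * f t)"
      using S(2) by (intro sum.cong) (auto simp: \<psi>_def)
    then show ?thesis
      using S by (simp add: \<psi>_def sum_distrib_right right_diff_distrib sum_subtractf)
  qed
  \<comment> \<open>This rests on
    \<open>t^(j+1) - a^(j+1) = a * (t^j - a^j) + t^j * (t - a)\<close>.\<close>
  have step: "(\<Sum>s\<in>S. \<psi> s * s ^ Suc j) = a * (\<Sum>s\<in>S. \<psi> s * s ^ j) + (\<Sum>s\<in>T. \<phi> s * s ^ j)" for j
  proof -
    have "\<phi> t / (t - a) * (t ^ Suc j - a ^ Suc j) =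
        a * (\<phi> t / (t - a) * (t ^ j - a ^ j)) + \<phi> t * t ^ j" if "t \<in> T" for t
    proof -
      have "t - a \<noteq> 0" using that S(2) by auto
      then show ?thesis by (simp add: field_simps)
    qed
    then show ?thesis
      unfolding \<psi>_sum by (simp add: sum_distrib_left sum.distrib[symmetric])
  qed
  have zero: "(\<Sum>s\<in>S. \<psi> s * s ^ j) = 0" if "j \<le> k" for j
    using that
  proof (induction j)
    case 0
    show ?case using \<psi>_sum[of "\<lambda>_. 1"] by simp
  next
    case (Suc j)
    then show ?case using step[of j] \<phi>[of j] by simp
  qed
  have "(\<Sum>s\<in>S. \<psi> s * s ^ Suc k) = 1"
    using step[of k] \<phi>[of k] zero[of k] by simp
  then show ?case
    using zero by (intro exI[of _ \<psi>]) (auto simp: le_Suc_eq)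
qed

text \<open>The zero polynomial is homogeneous of every degree, which covers empty vertex sums and
  differences that vanish.\<close>

definition homogeneous_on :: "'x set \<Rightarrow> nat \<Rightarrow> 'x mpolynomial \<Rightarrow> bool" where
  "homogeneous_on E m P \<longleftrightarrow>
    (\<forall>M\<in>Poly_Mapping.keys P. Poly_Mapping.keys M \<subseteq> E \<and> sum (Poly_Mapping.lookup M) E = m)"

lemma homogeneous_on_pvar: "finite E \<Longrightarrow> x \<in> E \<Longrightarrow> homogeneous_on E 1 (pvar x)"
  by (auto simp: homogeneous_on_def pvar_def lookup_single when_def)

lemma homogeneous_on_sum:
  "(\<And>i. i \<in> I \<Longrightarrow> homogeneous_on E m (f i)) \<Longrightarrow> homogeneous_on E m (sum f I)"
  unfolding homogeneous_on_def using keys_sum by fastforce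

lemma homogeneous_on_diff:
  "homogeneous_on E m P \<Longrightarrow> homogeneous_on E m Q \<Longrightarrow> homogeneous_on E m (P - Q)"
  unfolding homogeneous_on_def
  by (metis (no_types, lifting) diff_zero in_keys_iff lookup_minus)

lemma homogeneous_on_mult:
  assumes "homogeneous_on E m P" "homogeneous_on E k Q"
  shows "homogeneous_on E (m + k) (P * Q)"
  unfolding homogeneous_on_def
proof
  fix K assume "K \<in> Poly_Mapping.keys (P * Q)"
  then obtain M N where K: "K = M + N" and "M \<in> Poly_Mapping.keys P" "N \<in> Poly_Mapping.keys Q"
    using keys_mult by blast
  then have "Poly_Mapping.keys M \<subseteq> E \<and> sum (Poly_Mapping.lookup M) E = m"
    "Poly_Mapping.keys N \<subseteq> E \<and> sum (Poly_Mapping.lookup N) E = k"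
    using assms by (auto simp: homogeneous_on_def)
  then show "Poly_Mapping.keys K \<subseteq> E \<and> sum (Poly_Mapping.lookup K) E = m + k"
    using keys_add[of M N] by (auto simp: K lookup_add sum.distrib)
qed

lemma homogeneous_on_prod:
  "(\<And>i. i \<in> I \<Longrightarrow> homogeneous_on E (m i) (f i)) \<Longrightarrow> homogeneous_on E (sum m I) (prod f I)"
  by (induction I rule: infinite_finite_induct) 
    (auto simp: homogeneous_on_mult, auto simp: homogeneous_on_def)

text \<open>A product of divided differences, one for each variable in \<open>E\<close>, maps
  \<open>P\<close> to its coefficient at \<open>M\<close>: any other monomial of \<open>P\<close>
  has the same total degree, hence a smaller exponent than \<open>M\<close> in some variable, and
  the divided difference in that variable annihilates it. As this coefficient is nonzero,
  \<open>P\<close> cannot vanish on the whole grid.\<close>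

lemma combinatorial_nullstellensatz:
  assumes E: "finite E" and M: "M \<in> Poly_Mapping.keys P" and hom: "homogeneous_on E m P"
    and L: "\<And>x. x \<in> E \<Longrightarrow> finite (L x) \<and> Poly_Mapping.lookup M x < card (L x)"
  shows "\<exists>w. (\<forall>x\<in>E. w x \<in> L x) \<and> mpoly_eval (\<lambda>a. a) w P \<noteq> 0"
proof (rule ccontr)
  assume contra: "\<not> ?thesis"
  \<comment> \<open>A divided difference has one node more than its order, so each list is cut down
    to that size.\<close>
  have "\<exists>S. S \<subseteq> L x \<and> card S = Suc (Poly_Mapping.lookup M x) \<and> finite S" if "x \<in> E" for x
    using L[OF that] by (meson Suc_leI obtain_subset_with_card_n)
  then obtain S where S: "\<And>x. x \<in> E \<Longrightarrow> S x \<subseteq> L x" "\<And>x. x \<in> E \<Longrightarrow> finite (S x)"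
    and card_S: "\<And>x. x \<in> E \<Longrightarrow> card (S x) = Suc (Poly_Mapping.lookup M x)"
    by metis
  have "\<forall>x\<in>E. \<exists>\<phi>. \<forall>j\<le>Poly_Mapping.lookup M x.
      (\<Sum>s\<in>S x. \<phi> s * s ^ j) = (if j = Poly_Mapping.lookup M x then 1 else 0)"
    using divided_difference_exists S(2) card_S by blast
  from bchoice[OF this] obtain \<phi> where \<phi>: "\<And>x j. x \<in> E \<Longrightarrow> j \<le> Poly_Mapping.lookup M x \<Longrightarrow>
      (\<Sum>s\<in>S x. \<phi> x s * s ^ j) = (if j = Poly_Mapping.lookup M x then 1 else 0)"
    by blast
  have monom: "(\<Sum>w\<in>PiE E S. (\<Prod>x\<in>E. \<phi> x (w x)) * monom_eval w N) = (if N = M then 1 else 0)"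
    if N: "N \<in> Poly_Mapping.keys P" for N
  proof -
    have keys: "Poly_Mapping.keys N \<subseteq> E" "Poly_Mapping.keys M \<subseteq> E"
      and deg: "sum (Poly_Mapping.lookup N) E = sum (Poly_Mapping.lookup M) E"
      using hom N M by (auto simp: homogeneous_on_def)
    have "(\<Sum>w\<in>PiE E S. (\<Prod>x\<in>E. \<phi> x (w x)) * monom_eval w N) =
        (\<Sum>w\<in>PiE E S. \<Prod>x\<in>E. \<phi> x (w x) * w x ^ Poly_Mapping.lookup N x)"
      by (simp add: monom_eval_superset[OF E keys(1)] prod.distrib)
    also have "\<dots> = (\<Prod>x\<in>E. \<Sum>s\<in>S x. \<phi> x s * s ^ Poly_Mapping.lookup N x)"
      using E S(2) by (simp add: prod_sum_PiE)
    also have "\<dots> = (if N = M then 1 else 0)"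
    proof (cases "N = M")
      case True
      then show ?thesis using \<phi> by simp
    next
      case False
      have "\<exists>x\<in>E. Poly_Mapping.lookup N x < Poly_Mapping.lookup M x"
      proof (rule ccontr)
        assume *: "\<not> ?thesis"
        have eq: "Poly_Mapping.lookup M x = Poly_Mapping.lookup N x" if "x \<in> E" for x
          using * by (intro sum_mono_inv[OF deg[symmetric] _ that E]) (auto simp: not_less)
        have "Poly_Mapping.lookup N x = Poly_Mapping.lookup M x" for x
          using eq keys by (metis in_keys_iff subsetD)
        then have "N = M" by (rule poly_mapping_eqI)
        with False show False by blast
      qed
      then obtain x where x: "x \<in> E" "Poly_Mapping.lookup N x < Poly_Mapping.lookup M x"
        by blast
      then have "(\<Sum>s\<in>S x. \<phi> x s * s ^ Poly_Mapping.lookup N x) = 0"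
        using \<phi>[of x "Poly_Mapping.lookup N x"] by simp
      with False E x(1) show ?thesis by (auto intro!: prod_zero)
    qed
    finally show ?thesis .
  qed
  have "(\<Sum>w\<in>PiE E S. (\<Prod>x\<in>E. \<phi> x (w x)) * mpoly_eval (\<lambda>a. a) w P) =
      (\<Sum>N\<in>Poly_Mapping.keys P. Poly_Mapping.lookup P N *
        (\<Sum>w\<in>PiE E S. (\<Prod>x\<in>E. \<phi> x (w x)) * monom_eval w N))"
    unfolding mpoly_eval_def sum_distrib_left
    by (subst sum.swap) (simp add: mult.left_commute)
  also have "\<dots> = (\<Sum>N\<in>Poly_Mapping.keys P. if N = M then Poly_Mapping.lookup P M else 0)"
    by (intro sum.cong refl) (auto simp: monom)
  also have "\<dots> = Poly_Mapping.lookup P M"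
    using M by simp
  finally have "(\<Sum>w\<in>PiE E S. (\<Prod>x\<in>E. \<phi> x (w x)) * mpoly_eval (\<lambda>a. a) w P) \<noteq> 0"
    using M by (simp add: in_keys_iff)
  then obtain w where "w \<in> PiE E S" "mpoly_eval (\<lambda>a. a) w P \<noteq> 0"
    by (metis (no_types, lifting) mult_zero_right sum.neutral)
  then show False
    using contra S(1) by (meson PiE_mem subsetD)
qed

section \<open>From the monomial index to list weightings\<close>

lemma simple_graph_finite_edges: "simple_graph G \<Longrightarrow> finite (edges G)"
  unfolding simple_graph_def by (meson PowI finite_Pow_iff finite_subset subsetI)

text \<open>A weighting is proper as soon as the orientation polynomial does not vanish at it, since
  every edge contributes the difference of its two end sums as a factor. A monomial with all
  exponents at most \<open>k\<close> lets the Nullstellensatz choose from lists of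
  \<open>k + 1\<close> numbers. If the index is infinite, the bound is trivial.\<close>

lemma edge_weight_choosability_le:
  assumes G: "simple_graph G"
  shows "edge_weight_choosability G \<le> graph_mind G + 1"
proof (cases "graph_mind G")
  case (enat k)
  obtain D where D: "orientation G D"
    using orientation_exists[OF G] by blast
  have fin: "finite (edges G)"
    using G by (rule simple_graph_finite_edges)
  have "has_monom_le (\<lambda>_. k) (orientation_poly G D)"
    using enat graph_mind_eq[OF D] by (simp add: poly_mind_le_iff[symmetric])
  then obtain M where M: "M \<in> Poly_Mapping.keys (orientation_poly G D)"
    and M_le: "\<And>x. Poly_Mapping.lookup M x \<le> k"
    by (auto simp: has_monom_le_def)
  have "homogeneous_on (edges G) 1 (vertex_poly G v)" for v
    unfolding vertex_poly_def
    by (intro homogeneous_on_sum homogeneous_on_pvar fin) (auto simp: incident_edges_def)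
  then have hom: "homogeneous_on (edges G) (\<Sum>p\<in>D. 1) (orientation_poly G D)"
    unfolding orientation_poly_def
    by (intro homogeneous_on_prod) (auto intro: homogeneous_on_diff)
  have "edge_weight_choosable (k + 1) G"
    unfolding edge_weight_choosable_def
  proof (intro allI impI)
    fix L :: "'a set \<Rightarrow> real set"
    assume L: "\<forall>e\<in>edges G. finite (L e) \<and> card (L e) = k + 1"
    have "finite (L e) \<and> Poly_Mapping.lookup M e < card (L e)" if "e \<in> edges G" for e
      using L that M_le[of e] by (simp add: less_Suc_eq_le)
    from combinatorial_nullstellensatz[OF fin M hom this]
    obtain w where w: "\<forall>e\<in>edges G. w e \<in> L e"
      and nz: "mpoly_eval (\<lambda>a. a) w (orientation_poly G D) \<noteq> 0"
      by blast
    have "finite D"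
      using D fin unfolding orientation_def by (simp add: bij_betw_finite)
    have ne: "(\<Sum>e\<in>incident_edges G v. w e) \<noteq> (\<Sum>e\<in>incident_edges G u. w e)"
      if "(u, v) \<in> D" for u v
    proof
      assume "(\<Sum>e\<in>incident_edges G v. w e) = (\<Sum>e\<in>incident_edges G u. w e)"
      then have "mpoly_eval (\<lambda>a. a) w (orientation_poly G D) = 0"
        unfolding real_id.eval_orientation_poly using that \<open>finite D\<close>
        by (intro prod_zero bexI[of _ "(u, v)"]) simp_all
      with nz show False by contradiction
    qed
    have "proper_edge_weighting G w"
      unfolding proper_edge_weighting_def
    proof (intro allI impI)
      fix u v assume "{u, v} \<in> edges G"
      then have "{u, v} \<in> (\<lambda>(u, v). {u, v}) ` D"
        using D unfolding orientation_def by (simp add: bij_betw_def)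
      then obtain p where "p \<in> D" "{u, v} = (\<lambda>(u, v). {u, v}) p"
        by (elim imageE) simp
      then obtain a b where ab: "(a, b) \<in> D" "{u, v} = {a, b}"
        by (cases p) simp
      then consider "u = a" "v = b" | "u = b" "v = a"
        by (auto simp: doubleton_eq_iff)
      then show "(\<Sum>e\<in>incident_edges G u. w e) \<noteq> (\<Sum>e\<in>incident_edges G v. w e)"
        using ne[OF ab(1)] by cases auto
    qed
    with w show "\<exists>w. (\<forall>e\<in>edges G. w e \<in> L e) \<and> proper_edge_weighting G w"
      by blast
  qed
  then have "edge_weight_choosability G \<le> enat (k + 1)"
    unfolding edge_weight_choosability_def by (intro INF_lower) auto
  then show ?thesis using enat by (simp add: one_enat_def)
qed simp

section \<open>Cartesian products with a regular graph\<close>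

lemma doubleton_edges_cart_prod_iff:
  "{p, q} \<in> edges (G \<box> H) \<longleftrightarrow>
    p \<in> verts G \<times> verts H \<and> q \<in> verts G \<times> verts H \<and>
    (fst p = fst q \<and> {snd p, snd q} \<in> edges H \<or> snd p = snd q \<and> {fst p, fst q} \<in> edges G)"
proof -
  obtain u u' v v' where "p = (u, u')" "q = (v, v')"
    by fastforce
  then show ?thesis
    by (auto simp: cart_prod_def doubleton_eq_iff insert_commute)
qed

lemma simple_graph_edgeE:
  assumes "simple_graph G" "e \<in> edges G"
  obtains a b where "e = {a, b}" "a \<noteq> b" "a \<in> verts G" "b \<in> verts G"
  using assms by (auto simp: simple_graph_def card_2_iff)

lemma simple_graph_no_loop: "simple_graph G \<Longrightarrow> {a} \<notin> edges G"
  by (auto simp: simple_graph_def)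

lemma simple_graph_cart_prod:
  assumes "simple_graph G" "simple_graph H"
  shows "simple_graph (G \<box> H)"
  unfolding simple_graph_def
proof (intro conjI ballI)
  show "finite (verts (G \<box> H))"
    using assms by (simp add: cart_prod_def simple_graph_def)
  fix e assume e: "e \<in> edges (G \<box> H)"
  then obtain p q where pq: "e = {p, q}"
    by (auto simp: cart_prod_def)
  have *: "{p, q} \<in> edges (G \<box> H)"
    using e pq by simp
  then show "e \<subseteq> verts (G \<box> H)"
    unfolding doubleton_edges_cart_prod_iff pq by (simp add: cart_prod_def)
  have "p \<noteq> q"
    using * simple_graph_no_loop[OF assms(1)] simple_graph_no_loop[OF assms(2)]
    by (auto simp: doubleton_edges_cart_prod_iff)
  then show "card e = 2"
    by (simp add: pq)
qed

text \<open>The copy is recorded by its edges rather than its vertices, since edges of the product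
  are the variables to be shifted.\<close>

definition copy :: "'b graph \<Rightarrow> 'a \<Rightarrow> ('a \<times> 'b) set set" where
  "copy H v = (`) (Pair v) ` edges H"

lemma inj_on_image_Pair: "inj_on ((`) (Pair v)) A"
  by (intro inj_onI) (simp add: inj_image_eq_iff inj_on_def)

locale oriented_regular_product =
  fixes G :: "'a graph" and H :: "'b graph" and r :: nat
    and D :: "(('a \<times> 'b) \<times> ('a \<times> 'b)) set"
  assumes G: "simple_graph G" and H: "simple_graph H"
    and reg: "regular_of_degree r H" and r_pos: "r > 0"
    and D: "orientation (G \<box> H) D"
begin

lemma finite_edges: "finite (edges (G \<box> H))"
  using simple_graph_cart_prod[OF G H] by (rule simple_graph_finite_edges)

lemma arc_edge: "(p, q) \<in> D \<Longrightarrow> {p, q} \<in> edges (G \<box> H)"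
  using D by (auto simp: orientation_def bij_betw_def)

lemma edge_arc:
  assumes "{p, q} \<in> edges (G \<box> H)"
  shows "(p, q) \<in> D \<or> (q, p) \<in> D"
proof -
  have "{p, q} \<in> (\<lambda>(u, v). {u, v}) ` D"
    using assms D unfolding orientation_def by (simp add: bij_betw_def)
  then show ?thesis
    by (auto simp: doubleton_eq_iff)
qed

lemma finite_arcs: "finite D"
  using D finite_edges unfolding orientation_def by (simp add: bij_betw_finite)

lemma incident_edges_Int_copy:
  assumes "v \<in> verts G"
  shows "incident_edges (G \<box> H) (u, h) \<inter> copy H v =
    (if u = v then (`) (Pair v) ` incident_edges H h else {})"
proof -
  have "Pair v ` e \<in> edges (G \<box> H)" if e: "e \<in> edges H" for e
  proof -
    obtain a b where "e = {a, b}" "a \<in> verts H" "b \<in> verts H"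
      using simple_graph_edgeE[OF H e] by metis
    then show ?thesis
      using e assms by (simp add: doubleton_edges_cart_prod_iff)
  qed
  then show ?thesis
    by (auto simp: incident_edges_def copy_def)
qed

lemma card_incident_edges_Int_copy:
  assumes "v \<in> verts G" "p \<in> verts G \<times> verts H"
  shows "card (incident_edges (G \<box> H) p \<inter> copy H v) = (if fst p = v then r else 0)"
proof -
  obtain u h where p: "p = (u, h)" by fastforce
  show ?thesis
    using assms(2) reg unfolding p incident_edges_Int_copy[OF assms(1)]
    by (simp add: card_image[OF inj_on_image_Pair] regular_of_degree_def vdegree_def)
qed

lemma copy_disjoint:
  assumes "u \<noteq> v"
  shows "copy H u \<inter> copy H v = {}"
proof (rule ccontr)
  assume "\<not> ?thesis"
  then obtain e e' where e: "e \<in> edges H" "Pair u ` e = Pair v ` e'"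
    by (auto simp: copy_def)
  obtain a b where "e = {a, b}"
    using simple_graph_edgeE[OF H e(1)] by metis
  then have "(u, a) \<in> Pair v ` e'"
    unfolding e(2)[symmetric] by simp
  with assms show False by blast
qed

lemma avoids_vertex_poly:
  assumes "v \<in> verts G" "fst p \<noteq> v"
  shows "avoids (copy H v) (vertex_poly (G \<box> H) p)"
  unfolding vertex_poly_def
proof (intro avoids_sum avoids_pvar)
  fix e assume "e \<in> incident_edges (G \<box> H) p"
  then show "e \<notin> copy H v"
    using incident_edges_Int_copy[OF assms(1), of "fst p" "snd p"] assms(2) by auto
qed

section \<open>Factors of the orientation polynomial by layers\<close>

abbreviation difference :: "('a \<times> 'b) \<times> ('a \<times> 'b) \<Rightarrow> ('a \<times> 'b) set mpolynomial" where
  "difference \<equiv> \<lambda>(p, q). vertex_poly (G \<box> H) q - vertex_poly (G \<box> H) p"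

definition arcs_within :: "'a set \<Rightarrow> (('a \<times> 'b) \<times> ('a \<times> 'b)) set" where
  "arcs_within S = {(p, q) \<in> D. fst p \<in> S \<and> fst q \<in> S}"

text \<open>Only the factors are restricted to \<open>S\<close>; the vertex sums remain those of the
  whole product. Edges between copies, also those leaving \<open>S\<close>, may therefore occur as
  variables.\<close>

definition layer_poly :: "'a set \<Rightarrow> ('a \<times> 'b) set mpolynomial" where
  "layer_poly S = prod difference (arcs_within S)"

lemma layer_poly_verts: "layer_poly (verts G) = orientation_poly (G \<box> H) D"
proof -
  have "arcs_within (verts G) = D"
    unfolding arcs_within_def using arc_edge
    by (auto simp: doubleton_edges_cart_prod_iff)
  then show ?thesis
    by (simp add: layer_poly_def orientation_poly_def)
qed

lemma avoids_layer_poly: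
  assumes "v \<in> verts G" "v \<notin> S"
  shows "avoids (copy H v) (layer_poly S)"
  unfolding layer_poly_def
proof (rule avoids_prod)
  fix x assume "x \<in> arcs_within S"
  then obtain p q where "x = (p, q)" "fst p \<in> S" "fst q \<in> S"
    by (auto simp: arcs_within_def)
  then show "avoids (copy H v) (difference x)"
    using assms by (auto intro!: avoids_diff avoids_vertex_poly)
qed

text \<open>By regularity each vertex of the copy meets exactly \<open>r\<close> shifted edges. The
  coefficient of \<open>s\<close> is thus \<open>\<plusminus>r\<close> if the arc has one end in the
  copy, and zero if it has both or none.\<close>

lemma shift_difference:
  assumes "v \<in> verts G" "(p, q) \<in> D"
  shows "shift (copy H v) (difference (p, q)) =
    [:difference (p, q),
      const_poly ((if fst q = v then real r else 0) - (if fst p = v then real r else 0)):]"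
proof -
  have pq: "p \<in> verts G \<times> verts H" "q \<in> verts G \<times> verts H"
    using arc_edge[OF assms(2)] by (auto simp: doubleton_edges_cart_prod_iff)
  have "shift (copy H v) (difference (p, q)) =
      shift (copy H v) (vertex_poly (G \<box> H) q) - shift (copy H v) (vertex_poly (G \<box> H) p)"
    by (simp add: shift_def real_const_poly.eval_diff)
  also have "\<dots> = [:difference (p, q), const_poly (real (if fst q = v then r else 0)) -
      const_poly (real (if fst p = v then r else 0)):]"
    unfolding shift_vertex_poly[OF finite_edges] card_incident_edges_Int_copy[OF assms(1) pq(1)]
      card_incident_edges_Int_copy[OF assms(1) pq(2)]
    by simp
  finally show ?thesis
    by (simp add: single_diff)
qed

text \<open>This is where regularity enters: translating the variables of one copy of \<open>H\<close> moves all
  vertex sums of that copy by the same amount.\<close>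

lemma shift_layer_poly:
  assumes "v \<in> verts G" "S = {v} \<or> v \<notin> S"
  shows "shift (copy H v) (layer_poly S) = [:layer_poly S:]"
proof -
  have const: "(\<Prod>x\<in>A. [:f x:]) = [:prod f A:]" if "finite A"
    for A :: "'c set" and f :: "'c \<Rightarrow> ('a \<times> 'b) set mpolynomial"
    using that by (induction A rule: finite_induct) (auto simp: one_pCons)
  have "shift (copy H v) (layer_poly S) = (\<Prod>x\<in>arcs_within S. shift (copy H v) (difference x))"
    by (simp only: layer_poly_def shift_def real_const_poly.eval_prod)
  also have "\<dots> = (\<Prod>x\<in>arcs_within S. [:difference x:])"
  proof (rule prod.cong[OF refl])
    fix x assume "x \<in> arcs_within S"
    then obtain p q where x: "x = (p, q)" "(p, q) \<in> D" "fst p \<in> S" "fst q \<in> S"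
      by (auto simp: arcs_within_def)
    then have "fst p = v \<longleftrightarrow> fst q = v"
      using assms(2) by auto
    then show "shift (copy H v) (difference x) = [:difference x:]"
      unfolding x(1) shift_difference[OF assms(1) x(2)] by simp
  qed
  also have "\<dots> = [:layer_poly S:]"
    unfolding layer_poly_def
    by (rule const) (rule finite_subset[OF _ finite_arcs], auto simp: arcs_within_def)
  finally show ?thesis .
qed

text \<open>Any orientation computes the monomial index of \<open>H\<close>, so the arcs that
  \<open>D\<close> has inside the copy may be used for it.\<close>

lemma orientation_copy:
  assumes "v \<in> verts G"
  shows "orientation H {(h, h'). ((v, h), (v, h')) \<in> D}" (is "orientation H ?D")
  unfolding orientation_def
proof (rule bij_betw_imageI)
  have inj: "inj_on (\<lambda>(p, q). {p, q}) D"
    using D by (simp add: orientation_def bij_betw_def)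
  show "inj_on (\<lambda>(h, h'). {h, h'}) ?D"
  proof (rule inj_onI)
    fix x y assume x: "x \<in> ?D" and y: "y \<in> ?D"
      and eq: "(\<lambda>(h, h'). {h, h'}) x = (\<lambda>(h, h'). {h, h'}) y"
    obtain a b c d where xy: "x = (a, b)" "y = (c, d)" by fastforce
    have "((v, a), (v, b)) = ((v, c), (v, d))"
      by (rule inj_onD[OF inj]) (use x y eq xy in \<open>auto simp: doubleton_eq_iff\<close>)
    then show "x = y" by (simp add: xy)
  qed
  show "(\<lambda>(h, h'). {h, h'}) ` ?D = edges H"
  proof (intro equalityI subsetI)
    fix e assume "e \<in> (\<lambda>(h, h'). {h, h'}) ` ?D"
    then obtain a b where "e = {a, b}" "((v, a), (v, b)) \<in> D"
      by auto
    then show "e \<in> edges H"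
      using arc_edge[of "(v, a)" "(v, b)"] simple_graph_no_loop[OF G]
      by (auto simp: doubleton_edges_cart_prod_iff)
  next
    fix e assume e: "e \<in> edges H"
    obtain a b where ab: "e = {a, b}" "a \<in> verts H" "b \<in> verts H"
      using simple_graph_edgeE[OF H e] by metis
    then have "{(v, a), (v, b)} \<in> edges (G \<box> H)"
      using e assms by (simp add: doubleton_edges_cart_prod_iff)
    then consider "((v, a), (v, b)) \<in> D" | "((v, b), (v, a)) \<in> D"
      using edge_arc by blast
    then show "e \<in> (\<lambda>(h, h'). {h, h'}) ` ?D"
    proof cases
      case 1
      then show ?thesis by (intro image_eqI[of _ _ "(a, b)"]) (auto simp: ab(1))
    next
      case 2
      then show ?thesis by (intro image_eqI[of _ _ "(b, a)"]) (auto simp: ab(1))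
    qed
  qed
qed

text \<open>Setting the variables outside the copy to zero and renaming the others to edges of
  \<open>H\<close> turns the layer into the orientation polynomial of \<open>H\<close>. A monomial
  of the latter with exponents at most \<open>m\<close> is pulled back, with exponent zero outside
  the copy.\<close>

lemma has_monom_le_layer_singleton:
  assumes v: "v \<in> verts G" and m: "graph_mind H \<le> enat m"
  shows "has_monom_le (\<lambda>e. if e \<in> copy H v then m else 0) (layer_poly {v})"
proof -
  let ?D = "{(h, h'). ((v, h), (v, h')) \<in> D}"
  \<comment> \<open>The second projection inverts the embedding of the edges of \<open>H\<close>
    into the copy.\<close>
  let ?w = "\<lambda>e. if e \<in> copy H v then pvar (snd ` e) else 0 :: 'b set mpolynomial"
  have vertex: "mpoly_eval const_poly ?w (vertex_poly (G \<box> H) (v, h)) = vertex_poly H h" for h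
  proof -
    have "finite (incident_edges (G \<box> H) (v, h))"
      using finite_edges by (simp add: incident_edges_def)
    then have "mpoly_eval const_poly ?w (vertex_poly (G \<box> H) (v, h)) =
        (\<Sum>e\<in>incident_edges (G \<box> H) (v, h) \<inter> copy H v. pvar (snd ` e))"
      by (simp only: real_const.eval_vertex_poly sum.inter_restrict)
    also have "\<dots> = (\<Sum>e\<in>incident_edges H h. pvar (snd ` Pair v ` e))"
      by (simp only: incident_edges_Int_copy[OF v] if_True refl sum.reindex[OF inj_on_image_Pair] o_def)
    finally show ?thesis
      by (simp add: vertex_poly_def image_image)
  qed
  have arcs: "arcs_within {v} = (\<lambda>(h, h'). ((v, h), (v, h'))) ` ?D"
    by (force simp: arcs_within_def)
  have "mpoly_eval const_poly ?w (layer_poly {v}) =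
      (\<Prod>x\<in>arcs_within {v}. mpoly_eval const_poly ?w (difference x))"
    by (simp only: layer_poly_def real_const.eval_prod)
  also have "\<dots> = (\<Prod>(h, h')\<in>?D. vertex_poly H h' - vertex_poly H h)"
    unfolding arcs
    by (subst prod.reindex)
      (auto simp: inj_on_def real_const.eval_diff vertex intro!: prod.cong)
  finally have "mpoly_eval const_poly ?w (layer_poly {v}) = orientation_poly H ?D"
    by (simp only: orientation_poly_def)
  moreover have "has_monom_le (\<lambda>_. m) (orientation_poly H ?D)"
    using m graph_mind_eq[OF orientation_copy[OF v]] by (simp add: poly_mind_le_iff)
  ultimately obtain M where "M \<in> Poly_Mapping.keys (mpoly_eval const_poly ?w (layer_poly {v}))"
    and M_le: "\<And>x. Poly_Mapping.lookup M x \<le> m"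
    by (auto simp: has_monom_le_def)
  from keys_relabel[OF this(1)] obtain M' where M': "M' \<in> Poly_Mapping.keys (layer_poly {v})"
    and M'_le: "\<And>e. Poly_Mapping.lookup M' e \<le>
      (if e \<in> copy H v then Poly_Mapping.lookup M (snd ` e) else 0)"
    by blast
  have "Poly_Mapping.lookup M' e \<le> (if e \<in> copy H v then m else 0)" for e
    using M'_le[of e] M_le[of "snd ` e"] by (auto split: if_splits)
  with M' show ?thesis
    unfolding has_monom_le_def by (intro bexI[of _ M']) simp_all
qed

text \<open>An arc between the copy over \<open>v\<close> and the rest of \<open>S\<close> keeps its
  coordinate \<open>h\<close> in \<open>H\<close> and projects to an edge of
  \<open>induced_subgraph G S\<close> at \<open>v\<close>. These two data determine the underlying
  edge and, since \<open>D\<close> is an orientation, the arc.\<close>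

lemma card_cross_arcs_le:
  assumes "v \<in> S"
  shows "card {(p, q) \<in> D. fst p \<in> S \<and> fst q \<in> S \<and> (fst p = v) \<noteq> (fst q = v)} \<le>
    card (verts H) * vdegree (induced_subgraph G S) v" (is "card ?C \<le> _")
proof -
  let ?I = "incident_edges (induced_subgraph G S) v"
  have fin: "finite ?I" "finite (verts H)"
    using simple_graph_finite_edges[OF G] H
    by (auto simp: incident_edges_def induced_subgraph_def simple_graph_def)
  have inj: "inj_on (\<lambda>(p, q). {p, q}) ?C"
    by (rule inj_on_subset[of _ D]) (use D in \<open>auto simp: orientation_def bij_betw_def\<close>)
  have "(\<lambda>(p, q). {p, q}) ` ?C \<subseteq> (\<lambda>(e, h). e \<times> {h}) ` (?I \<times> verts H)"
  proof
    fix e assume "e \<in> (\<lambda>(p, q). {p, q}) ` ?C"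
    then obtain p q where pq: "e = {p, q}" "(p, q) \<in> D" "fst p \<in> S" "fst q \<in> S"
      "(fst p = v) \<noteq> (fst q = v)"
      by auto
    then have *: "snd p = snd q" "{fst p, fst q} \<in> edges G" "snd p \<in> verts H"
      using arc_edge[OF pq(2)] by (auto simp: doubleton_edges_cart_prod_iff)
    have "e = {fst p, fst q} \<times> {snd p}"
      using *(1) by (auto simp: pq(1) prod_eq_iff)
    moreover have "{fst p, fst q} \<in> ?I"
      using pq * by (auto simp: incident_edges_def induced_subgraph_def)
    ultimately show "e \<in> (\<lambda>(e, h). e \<times> {h}) ` (?I \<times> verts H)"
      using *(3) by (intro image_eqI[of _ _ "({fst p, fst q}, snd p)"]) auto
  qed
  then have "card ?C \<le> card ((\<lambda>(e, h). e \<times> {h}) ` (?I \<times> verts H))"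
    using fin by (subst card_image[OF inj, symmetric]) (intro card_mono, auto)
  also have "\<dots> \<le> card (?I \<times> verts H)"
    using fin by (intro card_image_le) auto
  finally show ?thesis
    by (simp add: card_cartesian_product vdegree_def mult.commute)
qed

text \<open>After the shift, the arcs \<open>C\<close> between the copy and the rest give
  \<open>card C\<close> linear factors in \<open>s\<close>, and all other factors are free of
  \<open>s\<close>. The coefficient of \<open>s^(card C)\<close> is thus a nonzero multiple of the
  product in \<open>le\<close>, and returning to \<open>layer_poly S\<close> costs at most
  \<open>card C\<close> in each variable of the copy.\<close>

lemma has_monom_le_layer_insert:
  assumes v: "v \<in> verts G" "v \<in> S"
    and le: "has_monom_le b (layer_poly (S - {v}) * layer_poly {v})"
  shows "has_monom_le
    (\<lambda>e. b e + (if e \<in> copy H v then card (verts H) * vdegree (induced_subgraph G S) v else 0))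
    (layer_poly S)"
proof -
  define C where "C = {(p, q) \<in> D. fst p \<in> S \<and> fst q \<in> S \<and> (fst p = v) \<noteq> (fst q = v)}"
  define c where "c x = (case x of (p, q) \<Rightarrow> (if fst q = v then real r else 0) - (if fst p = v then real r else 0))"
    for x :: "('a \<times> 'b) \<times> ('a \<times> 'b)"
  have fin: "finite C" "finite (arcs_within T)" for T
    by (rule finite_subset[OF _ finite_arcs]; auto simp: C_def arcs_within_def)+
  have "arcs_within S = arcs_within (S - {v}) \<union> arcs_within {v} \<union> C"
    using v(2) by (auto simp: arcs_within_def C_def)
  moreover have "arcs_within (S - {v}) \<inter> arcs_within {v} = {}"
    "(arcs_within (S - {v}) \<union> arcs_within {v}) \<inter> C = {}"
    by (auto simp: arcs_within_def C_def)
  ultimately have "layer_poly S = layer_poly (S - {v}) * layer_poly {v} * prod difference C"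
    unfolding layer_poly_def using fin by (simp only: prod.union_disjoint finite_UnI)
  then have "shift (copy H v) (layer_poly S) =
      shift (copy H v) (layer_poly (S - {v})) * shift (copy H v) (layer_poly {v}) *
      (\<Prod>x\<in>C. shift (copy H v) (difference x))"
    by (simp only: shift_def real_const_poly.eval_mult real_const_poly.eval_prod)
  also have "(\<Prod>x\<in>C. shift (copy H v) (difference x)) = (\<Prod>x\<in>C. [:difference x, const_poly (c x):])"
  proof (rule prod.cong[OF refl])
    fix x assume "x \<in> C"
    then obtain p q where x: "x = (p, q)" "(p, q) \<in> D"
      by (auto simp: C_def)
    show "shift (copy H v) (difference x) = [:difference x, const_poly (c x):]"
      unfolding x(1) shift_difference[OF v(1) x(2)] by (simp add: c_def)
  qed
  finally have "coeff (shift (copy H v) (layer_poly S)) (card C) =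
      layer_poly (S - {v}) * layer_poly {v} * (\<Prod>x\<in>C. const_poly (c x))"
    by (simp add: shift_layer_poly[OF v(1)] coeff_prod_linear[OF fin(1)] mult.assoc)
  also have "(\<Prod>x\<in>C. const_poly (c x)) = const_poly (prod c C)"
    using fin(1) by (induction C rule: finite_induct) (auto simp: mult_single)
  finally have coeff: "coeff (shift (copy H v) (layer_poly S)) (card C) =
      layer_poly (S - {v}) * layer_poly {v} * const_poly (prod c C)" .
  \<comment> \<open>Every arc in \<open>C\<close> has exactly one end in the copy, so each
    \<open>c x\<close> is \<open>r\<close> or \<open>-r\<close>.\<close>
  have "prod c C \<noteq> 0"
    using fin(1) r_pos by (auto simp: C_def c_def)
  from has_monom_le_mult_const[OF le this]
  have "has_monom_le b (coeff (shift (copy H v) (layer_poly S)) (card C))"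
    by (simp only: coeff)
  from has_monom_le_shift[OF this] show ?thesis
    by (rule has_monom_le_mono) (use card_cross_arcs_le[OF v(2)] in \<open>auto simp: C_def\<close>)
qed

text \<open>The monomial found uses only edges inside copies of \<open>H\<close>. This strengthening
  makes the product lemma applicable in the induction, because edges between copies can occur in
  both factors.\<close>

lemma has_monom_le_layer_poly:
  assumes deg: "degenerate d G" and m: "graph_mind H \<le> enat m"
    and "finite S" and "S \<subseteq> verts G"
  shows "has_monom_le (\<lambda>e. if e \<in> (\<Union>v\<in>S. copy H v) then card (verts H) * d + m else 0) (layer_poly S)"
  using assms(3,4)
proof (induction S rule: finite_psubset_induct)
  case (psubset S)
  show ?case
  proof (cases "S = {}")
    case True
    then show ?thesis
      by (simp add: layer_poly_def arcs_within_def has_monom_le_def)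
  next
    case False
    let ?k = "card (verts H) * d"
    \<comment> \<open>Degeneracy provides the vertex to be removed, which has at most
      \<open>d\<close> neighbours in the rest of \<open>S\<close>.\<close>
    obtain v where v: "v \<in> S" "vdegree (induced_subgraph G S) v \<le> d"
      using deg False psubset.prems by (auto simp: degenerate_def)
    then have vG: "v \<in> verts G"
      using psubset.prems by auto
    have IH: "has_monom_le (\<lambda>e. if e \<in> (\<Union>u\<in>S - {v}. copy H u) then ?k + m else 0) (layer_poly (S - {v}))"
      using psubset.IH[of "S - {v}"] psubset.prems v(1) by auto
    have "has_monom_le (\<lambda>e. (if e \<in> (\<Union>u\<in>S - {v}. copy H u) then ?k + m else 0) +
        (if e \<in> copy H v then m else 0)) (layer_poly (S - {v}) * layer_poly {v})"
    proof (rule has_monom_le_mult[OF IH has_monom_le_layer_singleton[OF vG m],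
          where A = "\<Union>u\<in>S - {v}. copy H u" and B = "copy H v"])
      show "(\<Union>u\<in>S - {v}. copy H u) \<inter> copy H v = {}"
        using copy_disjoint[of _ v] by blast
      show "Poly_Mapping.lookup M x = 0"
        if "M \<in> Poly_Mapping.keys (layer_poly (S - {v}))" "x \<in> copy H v" for M x
        using that avoids_layer_poly[OF vG, of "S - {v}"] by (simp add: avoids_def)
      show "Poly_Mapping.lookup M x = 0"
        if M: "M \<in> Poly_Mapping.keys (layer_poly {v})" and x: "x \<in> (\<Union>u\<in>S - {v}. copy H u)" for M x
      proof -
        obtain u where "u \<in> S - {v}" "x \<in> copy H u"
          using x by blast
        with M psubset.prems avoids_layer_poly[of u "{v}"] show ?thesis
          by (auto simp: avoids_def)
      qed
    qed simp_all
    from has_monom_le_layer_insert[OF vG v(1) this] show ?thesis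
    proof (rule has_monom_le_mono)
      fix e
      \<comment> \<open>The copies are disjoint. Variables over \<open>v\<close> have exponent at
        most \<open>m\<close> so far and are now raised by at most \<open>?k\<close>; those of the
        other copies are not raised again.\<close>
      have "e \<notin> copy H v" if "e \<in> (\<Union>u\<in>S - {v}. copy H u)"
        using that copy_disjoint[of _ v] by blast
      moreover have "card (verts H) * vdegree (induced_subgraph G S) v \<le> ?k"
        using v(2) by simp
      ultimately show "(if e \<in> (\<Union>u\<in>S - {v}. copy H u) then ?k + m else 0) +
          (if e \<in> copy H v then m else 0) +
          (if e \<in> copy H v then card (verts H) * vdegree (induced_subgraph G S) v else 0) \<le>
          (if e \<in> (\<Union>u\<in>S. copy H u) then ?k + m else 0)"
        using v(1) by auto
    qed
  qed
qed

lemma graph_mind_cart_prod_le: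
  assumes "degenerate d G"
  shows "graph_mind (G \<box> H) \<le> enat (card (verts H) * d) + graph_mind H"
proof (cases "graph_mind H")
  case (enat m)
  have "finite (verts G)"
    using G by (simp add: simple_graph_def)
  from has_monom_le_layer_poly[OF assms _ this order_refl, of m]
  have "has_monom_le (\<lambda>_. card (verts H) * d + m) (orientation_poly (G \<box> H) D)"
    unfolding layer_poly_verts by (rule has_monom_le_mono) (simp_all add: enat)
  then show ?thesis
    using enat by (simp add: graph_mind_eq[OF D] poly_mind_le_iff)
qed simp

end

theorem theorem5p2:
  fixes G :: "'a graph" and H :: "'b graph" and n d :: nat
  assumes "simple_graph H" and "regular H" and "card (verts H) = n" and "n \<ge> 3"
    and "\<exists>F. two_factor F H"
    and "simple_graph G" and "degenerate d G"
  shows "graph_mind (G \<box> H) \<le> enat (n * d) + graph_mind H \<and>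
         edge_weight_choosability (G \<box> H) \<le> enat (n * d) + graph_mind H + 1"
proof -
  obtain r where r: "regular_of_degree r H"
    using assms(2) by (auto simp: regular_def)
  obtain F where F: "two_factor F H"
    using assms(5) by blast
  obtain h where h: "h \<in> verts H"
    using assms(3,4) by fastforce
  \<comment> \<open>The two edges of the \<open>2\<close>-factor at \<open>h\<close> make the degree
    \<open>r\<close> positive, which keeps the leading coefficients of the shifted factors
    nonzero.\<close>
  have "r > 0"
  proof -
    have "incident_edges F h \<subseteq> incident_edges H h"
      using F by (auto simp: two_factor_def subgraph_def incident_edges_def)
    moreover have "card (incident_edges F h) = 2"
      using F h by (simp add: two_factor_def regular_of_degree_def vdegree_def)
    moreover have "finite (incident_edges H h)"
      using simple_graph_finite_edges[OF assms(1)] by (simp add: incident_edges_def)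
    ultimately have "card (incident_edges H h) > 0"
      by (auto simp: card_gt_0_iff)
    then show ?thesis
      using r h by (simp add: regular_of_degree_def vdegree_def)
  qed
  have simple: "simple_graph (G \<box> H)"
    using assms(1,6) by (intro simple_graph_cart_prod)
  then obtain D where "orientation (G \<box> H) D"
    using orientation_exists by blast
  with assms r \<open>r > 0\<close> interpret oriented_regular_product G H r D
    by unfold_locales
  have mind: "graph_mind (G \<box> H) \<le> enat (n * d) + graph_mind H"
    using graph_mind_cart_prod_le[OF assms(7)] assms(3) by simp
  moreover have "edge_weight_choosability (G \<box> H) \<le> enat (n * d) + graph_mind H + 1"
    using edge_weight_choosability_le[OF simple] add_right_mono[OF mind, of 1] by (rule order_trans)
  ultimately show ?thesis ..
qed

end
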